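(* Let $\bm{g}_0=\bm{g}_0(\vec{\bm{x}}_s,\omega)\in\mathbb{C}^N$ be the vector of direct arrivals, let $\bm{p}=\bm{p}(\vec{\bm{x}}_s,\omega)\in\mathbb{C}^N$ be the array response vector, and let $$\bm{d}=|\widehat{f}(\omega)|^2\,\mathrm{Re}\big[\overline{\bm{g}}_0\odot(\bm{g}_0+2\bm{p})\big]\in\mathbb{R}^N$$ be the vector of (linearized) intensity measurements. Provided $|\widehat{f}(\omega)|^2\neq 0$, the intensity measurements $\bm{d}$ determine $$\widetilde{\bm{p}}\equiv \bm{p}+(\overline{\bm{g}}_0)^{-1}\odot\bm{g}_0\odot\overline{\bm{p}},$$ where the inverse of a vector is understood componentwise. Moreover, $\widetilde{\bm{p}}$ can be obtained from $\bm{d}$ in about $2N$ complex operations (additions or multiplications) with the formula $$\widetilde{\bm{p}}=|\widehat{f}(\omega)|^{-2}(\overline{\bm{g}}_0)^{-1}\odot\bm{d}-\bm{g}_0 .$$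
   Context: Setting. The dimension is $d\in\{2,3\}$ (not to be confused with the data vector $\bm{d}$). A point source is located at $\vec{\bm{x}}_s\in\mathbb{R}^d$, and there are $N$ receivers at $\vec{\bm{x}}_1,\dots,\vec{\bm{x}}_N$ in an array $\mathcal{A}=[-a/2,a/2]^{d-1}\times\{0\}\subset\mathbb{R}^d$, $a>0$. The source is not in the array, so $\vec{\bm{x}}_r\neq\vec{\bm{x}}_s$ for all $r$. The background wave velocity is $c_0>0$, $\omega\in\mathbb{R}\setminus\{0\}$ is a fixed angular frequency, $k=\omega/c_0$ is the wave number, and $\widehat{f}(\omega)\in\mathbb{C}$ is the source illumination at frequency $\omega$. The medium has a compactly supported reflectivity $\rho$ with support $\mathcal{R}\subset\mathbb{R}^d$, such that the integral below is well defined. Green function of the Helmholtz equation in the homogeneous background: $$\widehat{G}_0(\vec{\bm{x}},\vec{\bm{y}},\omega)=\frac{\imath}{4}H_0^{(1)}(k|\vec{\bm{x}}-\vec{\bm{y}}|)\ \text{ if } d=2,\qquad \widehat{G}_0(\vec{\bm{x}},\vec{\bm{y}},\omega)=\frac{\exp(\imath k|\vec{\bm{x}}-\vec{\bm{y}}|)}{4\pi|\vec{\bm{x}}-\vec{\bm{y}}|}\ \text{ if } d=3,$$ where $H_0^{(1)}$ is the Hankel function of the first kind of order zero (principal branch). Direct arrivals (incident field at the array), for a point $\vec{\bm{y}}$: $$\bm{g}_0(\vec{\bm{y}},\omega)=\big[\widehat{G}_0(\vec{\bm{x}}_1,\vec{\bm{y}},\omega),\dots,\widehat{G}_0(\vec{\bm{x}}_N,\vec{\bm{y}},\omega)\big]^{\mathsf{T}}\in\mathbb{C}^N.$$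 Array response vector (scattered field at the array in the Born approximation): $$\bm{p}(\vec{\bm{x}}_s,\omega)=k^2\int_{\mathcal{R}}d\vec{\bm{z}}\;\bm{g}_0(\vec{\bm{z}},\omega)\,\widehat{G}_0(\vec{\bm{x}}_s,\vec{\bm{z}},\omega)\,\rho(\vec{\bm{z}})\in\mathbb{C}^N.$$ Notation. $\odot$ is the componentwise (Hadamard) product of vectors; the bar denotes componentwise complex conjugation; $\mathrm{Re}$ is taken componentwise. "$\bm{d}$ determines $\widetilde{\bm{p}}$" means that $\widetilde{\bm{p}}$ is a function of $\bm{d}$, where $\bm{g}_0$ and $|\widehat{f}(\omega)|^2$ are known and $\bm{p}$ is unknown. The vector $\bm{d}$ is the linearization of the exact intensities $|\widehat{f}(\omega)|^2\,\overline{(\bm{g}_0+\bm{p})}\odot(\bm{g}_0+\bm{p})$, obtained by dropping the term quadratic in $\bm{p}$; in this statement $\bm{d}$ is exactly the linearized vector. *)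

theory Defs
  imports "HOL-Analysis.Analysis"
begin

text \<open>Bessel and Hankel functions of order zero, by their standard power series. Since
  \<^const>\<open>Ln\<close> is the principal logarithm, with imaginary part in the half-open interval
  from \<open>- pi\<close> (excluded) to \<open>pi\<close> (included), these are the principal branches, and the value
  on the cut (the negative real axis) is the limit from above.\<close>

definition bessel_J0 :: "complex \<Rightarrow> complex" where
  "bessel_J0 z = (\<Sum>m. (-1) ^ m * (z / 2) ^ (2 * m) / (fact m)\<^sup>2)"

definition bessel_Y0 :: "complex \<Rightarrow> complex" where
  "bessel_Y0 z = 2 / of_real pi *
     ((Ln (z / 2) + euler_mascheroni) * bessel_J0 z
      + (\<Sum>m. (-1) ^ (m + 1) * harm m * (z / 2) ^ (2 * m) / (fact m)\<^sup>2))"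

definition hankel1_0 :: "complex \<Rightarrow> complex" where
  "hankel1_0 z = bessel_J0 z + \<i> * bessel_Y0 z"


text \<open>The product \<open>*\<close> of type \<^type>\<open>vec\<close> is the componentwise one.\<close>

abbreviation hadamard :: "'a::times ^ 'm \<Rightarrow> 'a ^ 'm \<Rightarrow> 'a ^ 'm" (infixl "\<odot>" 70) where
  "u \<odot> v \<equiv> u * v"

definition vmap :: "('a \<Rightarrow> 'b) \<Rightarrow> 'a ^ 'm \<Rightarrow> 'b ^ 'm" where
  "vmap h v = (\<chi> r. h (v $ r))"

abbreviation vcnj :: "complex ^ 'm \<Rightarrow> complex ^ 'm" where "vcnj \<equiv> vmap cnj"
abbreviation vinverse :: "complex ^ 'm \<Rightarrow> complex ^ 'm" where "vinverse \<equiv> vmap inverse"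
abbreviation vRe :: "complex ^ 'm \<Rightarrow> real ^ 'm" where "vRe \<equiv> vmap Re"
abbreviation vcomplex :: "real ^ 'm \<Rightarrow> complex ^ 'm" where "vcomplex \<equiv> vmap complex_of_real"


text \<open>The array lies in the hyperplane orthogonal to the coordinate axis \<open>l\<close>, which plays the
  role of the last coordinate (a finite index type carries no order).\<close>

definition receiver_array :: "'n \<Rightarrow> real \<Rightarrow> (real ^ 'n) set" where
  "receiver_array l a = {x. x $ l = 0 \<and> (\<forall>i. i \<noteq> l \<longrightarrow> x $ i \<in> {- (a / 2) .. a / 2})}"

text \<open>Only meant for dimensions 2 and 3. The wave number \<open>k\<close> may be negative.\<close>

definition green :: "real \<Rightarrow> real ^ 'n \<Rightarrow> real ^ 'n \<Rightarrow> complex" where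
  "green k x y =
     (if CARD('n) = 2 then \<i> / 4 * hankel1_0 (of_real (k * norm (x - y)))
      else exp (\<i> * of_real (k * norm (x - y))) / of_real (4 * pi * norm (x - y)))"

definition direct_arrivals :: "real \<Rightarrow> (real ^ 'n) ^ 'm \<Rightarrow> real ^ 'n \<Rightarrow> complex ^ 'm" where
  "direct_arrivals k xr y = (\<chi> r. green k (xr $ r) y)"

definition refl_support :: "(real ^ 'n \<Rightarrow> complex) \<Rightarrow> (real ^ 'n) set" where
  "refl_support \<rho> = closure (support_on UNIV \<rho>)"

definition born_integrand ::
    "real \<Rightarrow> (real ^ 'n) ^ 'm \<Rightarrow> real ^ 'n \<Rightarrow> (real ^ 'n \<Rightarrow> complex) \<Rightarrow> real ^ 'n \<Rightarrow> complex ^ 'm" where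
  "born_integrand k xr xs \<rho> z = (green k xs z * \<rho> z) *s direct_arrivals k xr z"

definition admissible_reflectivity ::
    "real \<Rightarrow> (real ^ 'n) ^ 'm \<Rightarrow> real ^ 'n \<Rightarrow> (real ^ 'n \<Rightarrow> complex) \<Rightarrow> bool" where
  "admissible_reflectivity k xr xs \<rho> \<longleftrightarrow>
     compact (refl_support \<rho>) \<and>
     set_integrable lebesgue (refl_support \<rho>) (born_integrand k xr xs \<rho>)"

definition array_response ::
    "real \<Rightarrow> (real ^ 'n) ^ 'm \<Rightarrow> real ^ 'n \<Rightarrow> (real ^ 'n \<Rightarrow> complex) \<Rightarrow> complex ^ 'm" where
  "array_response k xr xs \<rho> =
     k\<^sup>2 *\<^sub>R (LINT z:refl_support \<rho>|lebesgue. born_integrand k xr xs \<rho> z)"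

definition intensity_data :: "complex \<Rightarrow> complex ^ 'm \<Rightarrow> complex ^ 'm \<Rightarrow> real ^ 'm" where
  "intensity_data fhat g p = (cmod fhat)\<^sup>2 *\<^sub>R vRe (vcnj g \<odot> (g + 2 *s p))"

definition p_tilde :: "complex ^ 'm \<Rightarrow> complex ^ 'm \<Rightarrow> complex ^ 'm" where
  "p_tilde g p = p + vinverse (vcnj g) \<odot> g \<odot> vcnj p"

definition recovery_weights :: "complex \<Rightarrow> complex ^ 'm \<Rightarrow> complex ^ 'm" where
  "recovery_weights fhat g = inverse ((cmod fhat)\<^sup>2) *\<^sub>R vinverse (vcnj g)"


text \<open>Operation counts refer to straight-line programs over the complex numbers. Every
  instruction performs one addition, subtraction or multiplication and stores the result in the
  next free register. The operands are inputs or earlier results; there are no other constants.\<close>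

datatype 'v operand = Input 'v | Reg nat

datatype 'v instr =
    Add "'v operand" "'v operand"
  | Sub "'v operand" "'v operand"
  | Mul "'v operand" "'v operand"

fun operand_value :: "('v \<Rightarrow> complex) \<Rightarrow> complex list \<Rightarrow> 'v operand \<Rightarrow> complex" where
  "operand_value inp regs (Input v) = inp v"
| "operand_value inp regs (Reg j) = (if j < length regs then regs ! j else 0)"

fun exec_instr :: "('v \<Rightarrow> complex) \<Rightarrow> complex list \<Rightarrow> 'v instr \<Rightarrow> complex" where
  "exec_instr inp regs (Add u v) = operand_value inp regs u + operand_value inp regs v"
| "exec_instr inp regs (Sub u v) = operand_value inp regs u - operand_value inp regs v"
| "exec_instr inp regs (Mul u v) = operand_value inp regs u * operand_value inp regs v"

definition run_program :: "('v \<Rightarrow> complex) \<Rightarrow> 'v instr list \<Rightarrow> complex list" where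
  "run_program inp prog = foldl (\<lambda>regs ins. regs @ [exec_instr inp regs ins]) [] prog"

text \<open>A program for \<open>N\<close>-vectors comes with a map telling in which operand each component of
  the result is found.\<close>

definition program_output ::
    "('v \<Rightarrow> complex) \<Rightarrow> 'v instr list \<Rightarrow> ('m \<Rightarrow> 'v operand) \<Rightarrow> complex ^ 'm" where
  "program_output inp prog out = (\<chi> r. operand_value inp (run_program inp prog) (out r))"

text \<open>The recovery program reads the data, and two vectors known before any measurement: the
  direct arrivals and the weights \<^const>\<open>recovery_weights\<close>. The precomputation of the weights
  is not counted.\<close>

datatype 'm recovery_input = Data 'm | Weight 'm | Direct 'm

fun recovery_inputs ::
    "complex \<Rightarrow> complex ^ 'm \<Rightarrow> real ^ 'm \<Rightarrow> 'm recovery_input \<Rightarrow> complex" where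
  "recovery_inputs fhat g d (Data r) = complex_of_real (d $ r)"
| "recovery_inputs fhat g d (Weight r) = recovery_weights fhat g $ r"
| "recovery_inputs fhat g d (Direct r) = g $ r"

end

theory Submission
  imports Defs
begin

text \<open>
  Wherever no direct arrival vanishes, the formula is an identity in each component: with
  \<open>2 Re w = w + cnj w\<close>,
  \<open>Re (cnj g * (g + 2 * p)) = cnj g * g + cnj g * p + g * cnj p\<close>,
  and dividing by \<open>cnj g\<close> leaves \<open>g + p + inverse (cnj g) * g * cnj p\<close>, that is, \<open>g\<close> plus the
  component of \<^const>\<open>p_tilde\<close> (lemma \<open>p_tilde_eq_recovery\<close>). The right-hand side is a function
  of the data, and with the weights precomputed it costs one multiplication and one subtraction
  per component (lemma \<open>run_recovery_program\<close>).

  The analytic part is that the components of the direct arrivals are nonzero. In dimension 3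
  an exponential never vanishes. In dimension 2 the Hankel function must have no zero on the
  punctured real line. For real \<open>x \<noteq> 0\<close>, put \<open>t = (x / 2)\<^sup>2\<close>; then \<open>J\<^sub>0(x) = j(t)\<close> and
  \<open>Y\<^sub>0(x) = (2 / \<pi>) ((ln (x / 2) + \<gamma>) j(t) + s(t))\<close> with \<open>ln\<close> the principal
  logarithm and two entire power series \<open>j\<close>, \<open>s\<close> that
  have real coefficients, and a nonzero real zero of the Hankel function would be a common zero of \<open>j\<close>
  and \<open>s\<close>. The Wronskian of \<open>J\<^sub>0\<close> and \<open>Y\<^sub>0\<close> excludes this: freed of its logarithms and of the
  constant factor, \<open>x\<close> times the Wronskian is the power series \<open>2 t (j s' - s j') + j\<^sup>2\<close>, which
  Bessel's equation forces to be the constant \<open>1\<close>.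
\<close>

section \<open>Zeros of the Hankel function on the real line\<close>

text \<open>The power series \<open>j\<close> and \<open>s\<close> in the variable \<open>t = (x / 2)\<^sup>2\<close>.\<close>

definition J0_fps :: "real fps" where
  "J0_fps = Abs_fps (\<lambda>m. (-1) ^ m / (fact m)\<^sup>2)"

definition Y0_fps :: "real fps" where
  "Y0_fps = Abs_fps (\<lambda>m. (-1) ^ (m + 1) * harm m / (fact m)\<^sup>2)"

text \<open>In the variable \<open>t\<close>, the operator \<open>x d/dx\<close> is twice the Euler operator \<open>t d/dt\<close>.\<close>

definition fps_euler :: "real fps \<Rightarrow> real fps" where
  "fps_euler f = fps_X * fps_deriv f"

lemma fps_nth_euler [simp]: "fps_nth (fps_euler f) n = real n * fps_nth f n"
  by (cases n) (simp_all add: fps_euler_def)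

text \<open>Bessel's equation \<open>(x d/dx)\<^sup>2 J\<^sub>0 = - x\<^sup>2 J\<^sub>0\<close>.\<close>

lemma euler_euler_J0_fps: "fps_euler (fps_euler J0_fps) = - (fps_X * J0_fps)"
proof (rule fps_ext)
  fix n
  show "fps_nth (fps_euler (fps_euler J0_fps)) n = fps_nth (- (fps_X * J0_fps)) n"
    by (cases n) (simp_all add: J0_fps_def power2_eq_square divide_simps del: of_nat_Suc)
qed

text \<open>Bessel's equation for \<open>ln (x / 2) J\<^sub>0 + s\<close>: the logarithm contributes the inhomogeneity
  \<open>- 2 (x d/dx) J\<^sub>0\<close>.\<close>

lemma euler_euler_Y0_fps:
  "fps_euler (fps_euler Y0_fps) = - (fps_X * Y0_fps) - fps_euler J0_fps"
proof (rule fps_ext)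
  fix n
  show "fps_nth (fps_euler (fps_euler Y0_fps)) n
      = fps_nth (- (fps_X * Y0_fps) - fps_euler J0_fps) n"
  proof (cases n)
    case (Suc m)
    have "real (Suc m) \<noteq> 0" by simp
    then show ?thesis
      by (simp add: Suc J0_fps_def Y0_fps_def harm_Suc power2_eq_square field_simps
            del: of_nat_Suc)
  qed simp
qed

text \<open>Multiplied by \<open>t\<close>, the derivative involves only Euler operators, and the two Bessel
  equations make it cancel; the inhomogeneity is what the summand \<open>j\<^sup>2\<close> compensates. The
  constant is read off at \<open>t = 0\<close>, where \<open>j = 1\<close>.\<close>

lemma wronskian_fps:
  "2 * (J0_fps * fps_euler Y0_fps - Y0_fps * fps_euler J0_fps) + J0_fps * J0_fps = 1"
  (is "?W = 1")
proof -
  have "fps_X * fps_deriv ?W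
      = 2 * (J0_fps * fps_euler (fps_euler Y0_fps) - Y0_fps * fps_euler (fps_euler J0_fps))
        + 2 * (J0_fps * fps_euler J0_fps)"
    by (simp add: fps_euler_def algebra_simps)
  also have "\<dots> = 0"
    unfolding euler_euler_J0_fps euler_euler_Y0_fps by (simp add: algebra_simps)
  finally have "fps_deriv ?W = 0"
    by simp
  then have "?W = fps_const (fps_nth ?W 0)"
    unfolding fps_deriv_eq_0_iff .
  also have "fps_nth ?W 0 = 1"
    by (simp add: J0_fps_def)
  finally show ?thesis
    by simp
qed

text \<open>The exponential series converges everywhere and dominates both \<open>j\<close> and \<open>s\<close>, the latter
  since \<open>harm n\<close> is at most \<open>fact n\<close>.\<close>

lemma fps_conv_radius_eq_infinity:
  fixes f :: "real fps"
  assumes "\<And>n. norm (fps_nth f n) \<le> 1 / fact n"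
  shows "fps_conv_radius f = \<infinity>"
  unfolding fps_conv_radius_def
proof (rule conv_radius_inftyI'')
  fix x :: real
  have "summable (\<lambda>n. norm x ^ n / fact n)"
    using summable_exp_generic[of "norm x"] by (simp add: divide_inverse mult.commute)
  then show "summable (\<lambda>n. fps_nth f n * x ^ n)"
  proof (rule summable_comparison_test[rotated], intro exI allI impI)
    fix n
    show "norm (fps_nth f n * x ^ n) \<le> norm x ^ n / fact n"
      using mult_right_mono[OF assms[of n], of "norm x ^ n"]
      by (simp add: abs_mult power_abs)
  qed
qed

lemma harm_le_fact: "harm n \<le> (fact n :: real)"
proof (induction n)
  case (Suc n)
  show ?case
  proof (cases n)
    case (Suc m)
    have "inverse (real (Suc n)) \<le> 1"
      by (simp add: inverse_le_1_iff)
    also have "1 \<le> real n * fact n"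
      using mult_mono[of 1 "real n" 1 "fact n"] Suc by (simp add: fact_ge_1 del: fact_Suc)
    finally show ?thesis
      using Suc.IH by (simp add: harm_Suc algebra_simps)
  qed (simp add: harm_def)
qed (simp add: harm_def)

lemma J0_fps_conv_radius: "fps_conv_radius J0_fps = \<infinity>"
proof (rule fps_conv_radius_eq_infinity)
  fix n
  have "(1::real) / (fact n)\<^sup>2 \<le> 1 / fact n"
    using fact_ge_1[of n, where ?'a = real] by (simp add: power2_eq_square divide_simps)
  then show "norm (fps_nth J0_fps n) \<le> 1 / fact n"
    by (simp add: J0_fps_def norm_power)
qed

lemma Y0_fps_conv_radius: "fps_conv_radius Y0_fps = \<infinity>"
proof (rule fps_conv_radius_eq_infinity)
  fix n
  have "harm n / (fact n)\<^sup>2 \<le> 1 / (fact n :: real)"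
    using harm_le_fact[of n] by (simp add: power2_eq_square divide_simps)
  then show "norm (fps_nth Y0_fps n) \<le> 1 / fact n"
    by (simp add: Y0_fps_def abs_mult power_abs)
qed

lemma no_common_zero_J0_Y0_fps:
  assumes "eval_fps J0_fps t = 0"
  shows "eval_fps Y0_fps t \<noteq> 0"
proof
  assume Y: "eval_fps Y0_fps t = 0"
  \<comment> \<open>In the Wronskian, \<open>j\<close> and \<open>s\<close> occur only as factors; grouping it so keeps the
    derivatives from being evaluated.\<close>
  define A where "A = 2 * fps_euler Y0_fps + J0_fps"
  define B where "B = - (2 * fps_euler J0_fps)"
  have radius_euler: "fps_conv_radius (fps_euler f) = \<infinity>" if "fps_conv_radius f = \<infinity>" for f
    using fps_conv_radius_mult[of fps_X "fps_deriv f"] fps_conv_radius_deriv[of f] that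
    by (simp add: fps_euler_def)
  have radius_twice: "fps_conv_radius (2 * f) = \<infinity>" if "fps_conv_radius f = \<infinity>" for f :: "real fps"
    using fps_conv_radius_mult[of 2 f] that by simp
  have A: "fps_conv_radius A = \<infinity>"
    using fps_conv_radius_add[of "2 * fps_euler Y0_fps" J0_fps]
    by (simp add: A_def radius_twice radius_euler J0_fps_conv_radius Y0_fps_conv_radius)
  have B: "fps_conv_radius B = \<infinity>"
    by (simp add: B_def radius_twice radius_euler J0_fps_conv_radius)
  have JA: "fps_conv_radius (J0_fps * A) = \<infinity>"
    using fps_conv_radius_mult[of J0_fps A] by (simp add: A J0_fps_conv_radius)
  have YB: "fps_conv_radius (Y0_fps * B) = \<infinity>"
    using fps_conv_radius_mult[of Y0_fps B] by (simp add: B Y0_fps_conv_radius)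
  have "1 = J0_fps * A + Y0_fps * B"
    unfolding wronskian_fps[symmetric] A_def B_def by (simp add: algebra_simps)
  then have "1 = eval_fps (J0_fps * A + Y0_fps * B) t"
    by (metis eval_fps_1)
  also have "\<dots> = eval_fps J0_fps t * eval_fps A t + eval_fps Y0_fps t * eval_fps B t"
    by (simp add: eval_fps_add eval_fps_mult JA YB A B J0_fps_conv_radius Y0_fps_conv_radius)
  finally show False
    using assms Y by simp
qed

lemma suminf_complex_of_real_fps:
  assumes "fps_conv_radius f = \<infinity>"
  shows "(\<Sum>m. complex_of_real (fps_nth f m * t ^ m)) = of_real (eval_fps f t)"
  using sums_eval_fps[of t f] assms by (intro sums_unique[symmetric] sums_of_real) simp

lemma bessel_J0_of_real: "bessel_J0 (of_real x) = of_real (eval_fps J0_fps ((x / 2)\<^sup>2))"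
  unfolding suminf_complex_of_real_fps[OF J0_fps_conv_radius, symmetric] bessel_J0_def
  by (simp add: J0_fps_def power_mult)

lemma bessel_Y0_of_real:
  "bessel_Y0 (of_real x) = of_real (2 / pi) *
     ((Ln (of_real (x / 2)) + euler_mascheroni) * of_real (eval_fps J0_fps ((x / 2)\<^sup>2))
      + of_real (eval_fps Y0_fps ((x / 2)\<^sup>2)))"
proof -
  have "(\<Sum>m. (-1) ^ (m + 1) * harm m * (of_real x / 2) ^ (2 * m) / (fact m)\<^sup>2)
      = complex_of_real (eval_fps Y0_fps ((x / 2)\<^sup>2))"
    unfolding suminf_complex_of_real_fps[OF Y0_fps_conv_radius, symmetric]
    by (simp add: Y0_fps_def power_mult of_real_harm)
  then show ?thesis
    by (simp add: bessel_Y0_def bessel_J0_of_real)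
qed

text \<open>On the negative axis the logarithm has imaginary part \<open>\<pi>\<close>, which turns the real part of
  the Hankel function from \<open>J\<^sub>0\<close> into \<open>J\<^sub>0 - 2 J\<^sub>0 = - J\<^sub>0\<close>; so on either side a zero forces
  \<open>J\<^sub>0 = 0\<close>, and then \<open>s = 0\<close>.\<close>

lemma hankel1_0_of_real_nonzero:
  assumes "x \<noteq> 0"
  shows "hankel1_0 (of_real x) \<noteq> 0"
proof
  assume zero: "hankel1_0 (of_real x) = 0"
  define J where "J = eval_fps J0_fps ((x / 2)\<^sup>2)"
  define S where "S = eval_fps Y0_fps ((x / 2)\<^sup>2)"
  define \<theta> where "\<theta> = (if x > 0 then 0 else pi)"
  have Ln: "Ln (of_real (x / 2)) = of_real (ln \<bar>x / 2\<bar>) + \<i> * of_real \<theta>"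
  proof (cases "x > 0")
    case True
    then show ?thesis
      using Ln_of_real[of "x / 2"] by (simp add: \<theta>_def)
  next
    case False
    then have pos: "- x / 2 > 0"
      using assms by simp
    have "Ln (of_real (- x / 2) * - 1) = of_real (ln (- x / 2)) + Ln (- 1)"
      unfolding Ln_of_real[OF pos, symmetric] using pos by (intro Ln_times_of_real) auto
    then show ?thesis
      using False by (simp add: \<theta>_def)
  qed
  have euler: "Re euler_mascheroni = euler_mascheroni" "Im euler_mascheroni = 0"
    using Re_complex_of_real[of euler_mascheroni] Im_complex_of_real[of euler_mascheroni]
    by simp_all
  have "hankel1_0 (of_real x) = of_real J + \<i> * (of_real (2 / pi) *
      ((of_real (ln \<bar>x / 2\<bar> + euler_mascheroni) + \<i> * of_real \<theta>) * of_real J + of_real S))"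
    by (simp add: hankel1_0_def bessel_J0_of_real bessel_Y0_of_real Ln J_def S_def
        del: of_real_divide)
  also have "\<dots> = Complex (J - 2 / pi * \<theta> * J) (2 / pi * ((ln \<bar>x / 2\<bar> + euler_mascheroni) * J + S))"
    by (simp add: complex_eq_iff euler)
  finally have H: "J - 2 / pi * \<theta> * J = 0"
      "2 / pi * ((ln \<bar>x / 2\<bar> + euler_mascheroni) * J + S) = 0"
    using zero by (simp_all only: complex_eq_iff complex.sel zero_complex.sel)
  from H(1) have J: "J = 0"
    by (auto simp: \<theta>_def split: if_splits)
  with H(2) have "S = 0"
    by simp
  with J show False
    using no_common_zero_J0_Y0_fps unfolding J_def S_def by blast
qed

lemma green_nonzero:
  assumes "k \<noteq> 0" and "x \<noteq> y"
  shows "green k x y \<noteq> 0"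
  using assms hankel1_0_of_real_nonzero[of "k * norm (x - y)"] by (simp add: green_def)

section \<open>Recovery from linearized intensities\<close>

lemma p_tilde_eq_recovery:
  assumes "\<forall>r. g $ r \<noteq> 0" and "(cmod fhat)\<^sup>2 \<noteq> 0"
  shows "p_tilde g p = inverse ((cmod fhat)\<^sup>2) *\<^sub>R
    (vinverse (vcnj g) \<odot> vcomplex (intensity_data fhat g p)) - g"
proof (rule vec_eq_iff[THEN iffD2], rule allI)
  fix r
  define u v where "u = g $ r" and "v = p $ r"
  have u: "cnj u \<noteq> 0"
    using assms(1) by (simp add: u_def)
  have "complex_of_real (Re (cnj u * (u + 2 * v))) = cnj u * u + cnj u * v + u * cnj v"
    by (simp add: complex_eq_iff algebra_simps)
  then have main: "v + inverse (cnj u) * u * cnj v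
      = inverse (cnj u) * complex_of_real (Re (cnj u * (u + 2 * v))) - u"
    using u by (simp only: distrib_left) (simp add: field_simps)
  have "(inverse ((cmod fhat)\<^sup>2) *\<^sub>R
      (vinverse (vcnj g) \<odot> vcomplex (intensity_data fhat g p)) - g) $ r
    = of_real (inverse ((cmod fhat)\<^sup>2) * (cmod fhat)\<^sup>2)
      * (inverse (cnj u) * complex_of_real (Re (cnj u * (u + 2 * v)))) - u"
    unfolding intensity_data_def vmap_def u_def v_def vector_minus_component
      vector_scaleR_component vector_mult_component vec_lambda_beta vector_add_component
      vector_smult_component
    by (simp only: real_scaleR_def of_real_mult scaleR_conv_of_real ac_simps)
  also have "\<dots> = p_tilde g p $ r"
    using assms(2) main by (simp add: p_tilde_def vmap_def u_def v_def)
  finally show "p_tilde g p $ r = (inverse ((cmod fhat)\<^sup>2) *\<^sub>R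
      (vinverse (vcnj g) \<odot> vcomplex (intensity_data fhat g p)) - g) $ r"
    by (rule sym)
qed

section \<open>A straight-line program for the recovery formula\<close>

text \<open>A block of instructions that read no register written by the block itself acts in
  parallel on the registers present at its start.\<close>

lemma foldl_independent_instrs:
  assumes "\<And>ins ext. ins \<in> set prog \<Longrightarrow> exec_instr inp (regs @ ext) ins = exec_instr inp regs ins"
  shows "foldl (\<lambda>regs ins. regs @ [exec_instr inp regs ins]) regs prog
    = regs @ map (exec_instr inp regs) prog"
  using assms by (induction prog rule: rev_induct) simp_all

text \<open>Along an enumeration \<open>rs\<close> of the receivers: the registers below \<open>length rs\<close> hold the
  products of weights and data, the later ones the results.\<close>

definition recovery_program :: "'m list \<Rightarrow> 'm recovery_input instr list" where
  "recovery_program rs = map (\<lambda>r. Mul (Input (Weight r)) (Input (Data r))) rs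
     @ map (\<lambda>i. Sub (Reg i) (Input (Direct (rs ! i)))) [0..<length rs]"

lemma run_recovery_program:
  "run_program inp (recovery_program rs)
    = map (\<lambda>r. inp (Weight r) * inp (Data r)) rs
      @ map (\<lambda>r. inp (Weight r) * inp (Data r) - inp (Direct r)) rs"
proof -
  define prods where "prods = map (\<lambda>r. inp (Weight r) * inp (Data r)) rs"
  have "run_program inp (recovery_program rs)
      = foldl (\<lambda>regs ins. regs @ [exec_instr inp regs ins]) prods
          (map (\<lambda>i. Sub (Reg i) (Input (Direct (rs ! i)))) [0..<length rs])"
  proof -
    have "foldl (\<lambda>regs ins. regs @ [exec_instr inp regs ins]) []
        (map (\<lambda>r. Mul (Input (Weight r)) (Input (Data r))) rs) = prods"
      by (subst foldl_independent_instrs) (auto simp: prods_def)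
    then show ?thesis
      by (simp only: run_program_def recovery_program_def foldl_append)
  qed
  also have "\<dots> = prods @ map (\<lambda>i. prods ! i - inp (Direct (rs ! i))) [0..<length rs]"
    by (subst foldl_independent_instrs) (auto simp: prods_def nth_append)
  also have "map (\<lambda>i. prods ! i - inp (Direct (rs ! i))) [0..<length rs]
      = map (\<lambda>r. inp (Weight r) * inp (Data r) - inp (Direct r)) rs"
    by (rule nth_equalityI) (simp_all add: prods_def)
  finally show ?thesis
    by (simp add: prods_def)
qed

lemma ex_recovery_program:
  "\<exists>(prog :: 'm::finite recovery_input instr list) out. length prog = 2 * CARD('m) \<and>
     (\<forall>inp. program_output inp prog out
        = (\<chi> r. inp (Weight r) * inp (Data r) - inp (Direct r)))"
proof -
  obtain rs :: "'m list" where rs: "set rs = UNIV" "distinct rs"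
    using finite_distinct_list[OF finite] by blast
  have len: "length rs = CARD('m)"
    using distinct_card[OF rs(2)] rs(1) by simp
  have "\<forall>r. \<exists>i < length rs. rs ! i = r"
    using rs(1) by (metis UNIV_I in_set_conv_nth)
  then obtain idx where idx: "idx r < length rs" "rs ! idx r = r" for r
    by metis
  have "program_output inp (recovery_program rs) (\<lambda>r. Reg (length rs + idx r))
      = (\<chi> r. inp (Weight r) * inp (Data r) - inp (Direct r))" for inp
    by (simp add: program_output_def run_recovery_program nth_append idx)
  moreover have "length (recovery_program rs) = 2 * CARD('m)"
    by (simp add: recovery_program_def len)
  ultimately show ?thesis
    by blast
qed

section \<open>The response determined by the intensities\<close>

theorem proposition1:
  fixes xr :: "(real ^ 'n) ^ 'm" and xs :: "real ^ 'n" and l :: 'n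
    and a c0 \<omega> k :: real and fhat :: "real \<Rightarrow> complex" and g0 :: "complex ^ 'm"
  assumes dim: "CARD('n) \<in> {2, 3}"
    and a_pos: "a > 0"
    and receivers: "\<forall>r. xr $ r \<in> receiver_array l a"
    and source: "xs \<notin> receiver_array l a"
    and c0_pos: "c0 > 0"
    and omega_nz: "\<omega> \<noteq> 0"
    and k_eq: "k = \<omega> / c0"
    and illumination: "(cmod (fhat \<omega>))\<^sup>2 \<noteq> 0"
    and g0_eq: "g0 = direct_arrivals k xr xs"
  shows "(\<forall>r. g0 $ r \<noteq> 0)
    \<and> (\<exists>\<Phi> :: real ^ 'm \<Rightarrow> complex ^ 'm.
         \<forall>\<rho>. admissible_reflectivity k xr xs \<rho> \<longrightarrow>
           (let p = array_response k xr xs \<rho>; d = intensity_data (fhat \<omega>) g0 p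
            in p_tilde g0 p = \<Phi> d))
    \<and> (\<forall>\<rho>. admissible_reflectivity k xr xs \<rho> \<longrightarrow>
         (let p = array_response k xr xs \<rho>; d = intensity_data (fhat \<omega>) g0 p
          in p_tilde g0 p
               = inverse ((cmod (fhat \<omega>))\<^sup>2) *\<^sub>R (vinverse (vcnj g0) \<odot> vcomplex d) - g0))
    \<and> (\<exists>(prog :: 'm recovery_input instr list) out.
         length prog = 2 * CARD('m)
         \<and> (\<forall>d :: real ^ 'm.
              program_output (recovery_inputs (fhat \<omega>) g0 d) prog out
                = inverse ((cmod (fhat \<omega>))\<^sup>2) *\<^sub>R (vinverse (vcnj g0) \<odot> vcomplex d) - g0)
         \<and> (\<forall>\<rho>. admissible_reflectivity k xr xs \<rho> \<longrightarrow>
              (let p = array_response k xr xs \<rho>; d = intensity_data (fhat \<omega>) g0 p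
               in program_output (recovery_inputs (fhat \<omega>) g0 d) prog out = p_tilde g0 p)))"
proof -
  define \<Psi> :: "real ^ 'm \<Rightarrow> complex ^ 'm" where
    "\<Psi> d = inverse ((cmod (fhat \<omega>))\<^sup>2) *\<^sub>R (vinverse (vcnj g0) \<odot> vcomplex d) - g0" for d
  have g0_nonzero: "\<forall>r. g0 $ r \<noteq> 0"
  proof
    fix r
    have "k \<noteq> 0"
      using omega_nz c0_pos by (simp add: k_eq)
    moreover have "xr $ r \<noteq> xs"
      using receivers source by metis
    ultimately show "g0 $ r \<noteq> 0"
      by (simp add: g0_eq direct_arrivals_def green_nonzero)
  qed
  have recovery: "p_tilde g0 p = \<Psi> (intensity_data (fhat \<omega>) g0 p)" for p
    unfolding \<Psi>_def by (rule p_tilde_eq_recovery[OF g0_nonzero illumination])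
  obtain prog :: "'m recovery_input instr list" and out where
    len: "length prog = 2 * CARD('m)" and
    prog: "\<And>inp. program_output inp prog out
      = (\<chi> r. inp (Weight r) * inp (Data r) - inp (Direct r))"
    using ex_recovery_program by blast
  have prog_output: "program_output (recovery_inputs (fhat \<omega>) g0 d) prog out = \<Psi> d" for d
    by (simp add: prog \<Psi>_def vec_eq_iff recovery_weights_def vmap_def)
  show ?thesis
    unfolding \<Psi>_def[symmetric] Let_def
    by (intro conjI exI[of _ \<Psi>] exI[of _ prog] exI[of _ out] allI impI)
      (use g0_nonzero recovery len prog_output in auto)
qed

end
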